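(* Let $\alpha\in\mathbb{R}$. For all $\psi\in C_0^\infty(\mathbb{R}\setminus\{0\})$, $$\int_{\mathbb{R}}\frac{|\psi''(x)|^2}{|x|^\alpha}\,dx\ \ge\ \frac{(\alpha+1)^2}{4}\int_{\mathbb{R}}\frac{|\psi'(x)|^2}{|x|^{\alpha+2}}\,dx.$$
   Context: Functions are complex-valued; $C_0^\infty$ denotes smooth functions with compact support. *)

theory Defs
  imports "HOL-Analysis.Analysis"
begin

definition vderiv :: "(real \<Rightarrow> complex) \<Rightarrow> real \<Rightarrow> complex" where
  "vderiv f = (\<lambda>x. vector_derivative f (at x))"

definition smooth_on_open :: "real set \<Rightarrow> (real \<Rightarrow> complex) \<Rightarrow> bool" where
  "smooth_on_open S f \<longleftrightarrow> (\<forall>n. \<forall>x\<in>S. (vderiv ^^ n) f differentiable (at x))"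

text \<open>For open \<open>S\<close>, a function on \<open>S\<close> with compact support in \<open>S\<close> is represented by its
  extension by zero to the whole line. The support is the closure, taken in the whole line, of
  the set where the extension does not vanish; requiring it to be compact and contained in \<open>S\<close>
  says exactly that the support in \<open>S\<close> is compact, and it forces the extension to vanish
  outside \<open>S\<close>.\<close>

definition C0_infinity :: "real set \<Rightarrow> (real \<Rightarrow> complex) set" where
  "C0_infinity S = {f. smooth_on_open S f \<and>
     compact (closure {x. f x \<noteq> 0}) \<and> closure {x. f x \<noteq> 0} \<subseteq> S}"

end

theory Submission
  imports Defs
begin

text \<open>Put \<open>\<phi> = \<psi>'\<close>, \<open>c = (\<alpha> + 1) / 2\<close> and
  \<open>F x = \<bar>\<phi> x\<bar>\<^sup>2 x \<bar>x\<bar> powr (- \<alpha> - 2)\<close>. Expanding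
  \<open>\<bar>\<phi>' x - c \<phi> x / x\<bar>\<^sup>2 \<ge> 0\<close> and multiplying by \<open>\<bar>x\<bar> powr - \<alpha>\<close> gives
  the pointwise bound \<open>\<bar>\<phi>'\<bar>\<^sup>2 / \<bar>x\<bar> powr \<alpha> - c\<^sup>2 \<bar>\<phi>\<bar>\<^sup>2 / \<bar>x\<bar> powr (\<alpha> + 2) \<ge> c F'\<close>.
  As \<open>F\<close> is continuously differentiable with compact support, \<open>F'\<close> has integral zero.\<close>

lemma vderiv_eq_0_on_open:
  assumes "open U" "\<And>x. x \<in> U \<Longrightarrow> f x = 0" "x \<in> U"
  shows "vderiv f x = 0"
proof -
  have "(f has_vector_derivative 0) (at x)"
    by (rule has_vector_derivative_transform_within_open[of "\<lambda>_. 0" 0 x U])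
      (use assms in auto)
  then show ?thesis
    unfolding vderiv_def by (rule vector_derivative_at)
qed

text \<open>Meant for the origin: the weights may be singular there, so continuity is drawn from the
  vanishing of the functions nearby.\<close>

lemma isCont_if_eq_0_on_open:
  fixes f :: "'a::t2_space \<Rightarrow> 'b::real_normed_vector"
  assumes "open U" "\<And>x. x \<in> U \<Longrightarrow> f x = 0" "x \<in> U"
  shows "isCont f x"
proof -
  have "continuous_on U f"
    using assms(2) by (simp cong: continuous_on_cong)
  then show ?thesis
    using assms continuous_on_eq_continuous_at by blast
qed

lemma integrable_continuous_vanishing_outside:
  fixes f :: "real \<Rightarrow> real"
  assumes "\<And>x. isCont f x" "\<And>x. x \<notin> {a..b} \<Longrightarrow> f x = 0"
  shows "integrable lborel f"
proof -
  have "set_integrable lborel {a..b} f"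
    by (rule borel_integrable_atLeastAtMost') (use assms in \<open>simp add: continuous_at_imp_continuous_on\<close>)
  moreover have "(\<lambda>x. indicator {a..b} x *\<^sub>R f x) = f"
    using assms(2) by (force simp: indicator_def)
  ultimately show ?thesis
    by (simp add: set_integrable_def)
qed

text \<open>The fundamental theorem of calculus on \<open>{a..b}\<close>. The interval in the
  hypothesis on \<open>F\<close> is open so that \<open>F\<close> vanishes at both
  endpoints.\<close>

lemma integral_deriv_vanishing_outside:
  fixes F f :: "real \<Rightarrow> real"
  assumes der: "\<And>x. (F has_real_derivative f x) (at x)"
    and cont: "\<And>x. isCont f x"
    and F0: "\<And>x. x \<notin> {a<..<b} \<Longrightarrow> F x = 0"
    and f0: "\<And>x. x \<notin> {a..b} \<Longrightarrow> f x = 0"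
    and "a \<le> b"
  shows "(LINT x|lborel. f x) = 0"
proof -
  have "(\<integral>x. f x * indicator {a..b} x \<partial>lborel) = F b - F a"
    by (rule integral_FTC_Icc_real) (use assms in auto)
  moreover have "(\<lambda>x. f x * indicator {a..b} x) = f"
    using f0 by (force simp: indicator_def)
  ultimately show ?thesis
    using F0[of a] F0[of b] by simp
qed

text \<open>The product rule, where \<open>sgn x * x\<close> is the absolute value of
  \<open>x\<close> and lifts the exponent \<open>p - 1\<close> back to \<open>p\<close>. For
  \<open>p = - \<alpha> - 2\<close> the factor \<open>p + 1\<close> is
  \<open>- (\<alpha> + 1)\<close>, the source of the constant in the theorem.\<close>

lemma hardy_weight_has_derivative:
  fixes x p :: real
  assumes "x \<noteq> 0"
  shows "((\<lambda>x. x * \<bar>x\<bar> powr p) has_real_derivative (p + 1) * \<bar>x\<bar> powr p) (at x)"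
proof -
  have abs: "((\<lambda>x. \<bar>x\<bar>) has_real_derivative sgn x) (at x)"
  \<comment> \<open>On the open half-line of points with the same sign as \<open>x\<close>, the
    absolute value is the linear map \<open>y \<mapsto> sgn x * y\<close>.\<close>
  proof (rule has_field_derivative_transform_within_open[of "\<lambda>y. sgn x * y" _ _ "{y. 0 < x * y}"])
    show "((*) (sgn x) has_real_derivative sgn x) (at x)"
      by (auto intro!: derivative_eq_intros)
    show "open {y. 0 < x * y}"
      by (intro open_Collect_less continuous_intros)
  qed (use assms in \<open>auto simp: sgn_if zero_less_mult_iff\<close>)
  have "((\<lambda>x. x * \<bar>x\<bar> powr p) has_real_derivative
      1 * \<bar>x\<bar> powr p + (p * \<bar>x\<bar> powr (p - 1) * sgn x) * x) (at x)"
    by (intro DERIV_mult DERIV_ident DERIV_fun_powr[OF abs, simplified]) (use assms in auto)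
  moreover have "\<bar>x\<bar> powr (p - 1) * sgn x * x = \<bar>x\<bar> powr p"
    using assms by (simp add: powr_diff mult.assoc sgn_if)
  ultimately show ?thesis
    by (simp add: algebra_simps)
qed

text \<open>To be used with \<open>u\<close> and \<open>v\<close> the values of
  \<open>\<psi>'\<close> and \<open>\<psi>''\<close> at \<open>x\<close>; the left side is then
  \<open>c\<close> times the derivative of \<open>F\<close>.\<close>

lemma hardy_pointwise:
  fixes x \<alpha> :: real and u v :: "'a::real_inner"
  assumes "x \<noteq> 0"
  shows "(\<alpha> + 1) / 2 * (\<bar>x\<bar> powr (- \<alpha> - 2) * (2 * x * (u \<bullet> v) - (\<alpha> + 1) * (u \<bullet> u)))
    \<le> (norm v)\<^sup>2 / \<bar>x\<bar> powr \<alpha> - (\<alpha> + 1)\<^sup>2 / 4 * ((norm u)\<^sup>2 / \<bar>x\<bar> powr (\<alpha> + 2))"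
proof -
  define c where "c = (\<alpha> + 1) / 2"
  define w where "w = \<bar>x\<bar> powr (- \<alpha> - 2)"
  have w2: "1 / \<bar>x\<bar> powr (\<alpha> + 2) = w"
    by (simp add: w_def powr_minus_divide[symmetric])
  have w0: "1 / \<bar>x\<bar> powr \<alpha> = x\<^sup>2 * w"
    using assms by (simp add: w_def powr_diff powr_minus_divide)
  \<comment> \<open>Taking \<open>x\<close> inside the norm absorbs the factor between the two
    weights, so that \<open>w\<close> alone remains and no division by \<open>x\<close>
    occurs.\<close>
  have "0 \<le> w * (norm (x *\<^sub>R v - c *\<^sub>R u))\<^sup>2"
    by (simp add: w_def)
  \<comment> \<open>The square contributes \<open>c * c * (u \<bullet> u)\<close>, which is split as
    twice itself minus itself; the doubled part joins the cross term to form the derivative of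
    \<open>F\<close>.\<close>
  also have "\<dots> = (norm v)\<^sup>2 * (x\<^sup>2 * w) - c\<^sup>2 * ((norm u)\<^sup>2 * w)
      - c * (w * (2 * x * (u \<bullet> v) - 2 * c * (u \<bullet> u)))"
    unfolding power2_norm_eq_inner
    by (simp add: inner_diff inner_commute[of v u] power2_eq_square algebra_simps)
  finally have "c * (w * (2 * x * (u \<bullet> v) - 2 * c * (u \<bullet> u)))
      \<le> (norm v)\<^sup>2 * (x\<^sup>2 * w) - c\<^sup>2 * ((norm u)\<^sup>2 * w)"
    by simp
  moreover have "(norm v)\<^sup>2 / \<bar>x\<bar> powr \<alpha> = (norm v)\<^sup>2 * (x\<^sup>2 * w)"
    "(norm u)\<^sup>2 / \<bar>x\<bar> powr (\<alpha> + 2) = (norm u)\<^sup>2 * w"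
    by (simp_all only: w0[symmetric]) (simp_all flip: w2)
  moreover have "\<alpha> + 1 = 2 * c" "(\<alpha> + 1)\<^sup>2 / 4 = c\<^sup>2"
    by (simp_all add: c_def power_divide)
  ultimately show ?thesis
    by (simp flip: w_def)
qed

theorem theorem1p2:
  fixes \<alpha> :: real and \<psi> :: "real \<Rightarrow> complex"
  assumes "\<psi> \<in> C0_infinity (UNIV - {0})"
  shows "(LINT x|lborel. (cmod (vderiv (vderiv \<psi>) x))\<^sup>2 / \<bar>x\<bar> powr \<alpha>)
       \<ge> (\<alpha> + 1)\<^sup>2 / 4 * (LINT x|lborel. (cmod (vderiv \<psi> x))\<^sup>2 / \<bar>x\<bar> powr (\<alpha> + 2))"
proof -
  define \<phi> where "\<phi> = vderiv \<psi>"
  define d where "d = vderiv \<phi>"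
  define K where "K = closure {x. \<psi> x \<noteq> 0}"
  define U where "U = - K"
  have smooth: "(vderiv ^^ n) \<psi> differentiable (at x)" if "x \<noteq> 0" for n x
    using assms that unfolding C0_infinity_def smooth_on_open_def by auto
  \<comment> \<open>\<open>U\<close> is an open neighbourhood of the origin on which everything
    vanishes, which makes all singular weights harmless.\<close>
  have "compact K" and U0: "0 \<in> U"
    using assms unfolding C0_infinity_def K_def U_def by auto
  then obtain R where R: "\<And>x. x \<in> K \<Longrightarrow> norm x < R" and "R > 0"
    using compact_imp_bounded bounded_pos_less by metis
  \<comment> \<open>The points \<open>-R\<close> and \<open>R\<close> are included, as
    \<open>F\<close> has to vanish there.\<close>
  have U_outside: "x \<in> U" if "x \<notin> {-R<..<R}" for x
    using R[of x] that unfolding U_def by auto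
  have "open U"
    unfolding U_def K_def by auto
  have \<psi>0: "\<psi> x = 0" if "x \<in> U" for x
    using that closure_subset[of "{x. \<psi> x \<noteq> 0}"] unfolding U_def K_def by auto
  have \<phi>0: "\<phi> x = 0" if "x \<in> U" for x
    unfolding \<phi>_def using vderiv_eq_0_on_open[OF \<open>open U\<close> \<psi>0 that] .
  have d0: "d x = 0" if "x \<in> U" for x
    unfolding d_def using vderiv_eq_0_on_open[OF \<open>open U\<close> \<phi>0 that] .
  have \<phi>_deriv: "(\<phi> has_vector_derivative d x) (at x)" if "x \<noteq> 0" for x
    using smooth[OF that, of 1] unfolding d_def vderiv_def[of \<phi>]
    by (simp add: \<phi>_def vector_derivative_works)
  have \<phi>_cont: "isCont \<phi> x" if "x \<noteq> 0" for x
    using \<phi>_deriv[OF that] has_vector_derivative_continuous by blast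
  have d_cont: "isCont d x" if "x \<noteq> 0" for x
    using smooth[OF that, of 2] differentiable_imp_continuous_within
    by (simp add: d_def \<phi>_def numeral_2_eq_2)

  define g where "g x = (cmod (d x))\<^sup>2 / \<bar>x\<bar> powr \<alpha>" for x
  define h where "h x = (cmod (\<phi> x))\<^sup>2 / \<bar>x\<bar> powr (\<alpha> + 2)" for x
  define F where "F x = (\<phi> x \<bullet> \<phi> x) * (x * \<bar>x\<bar> powr (- \<alpha> - 2))" for x
  define f where "f x = \<bar>x\<bar> powr (- \<alpha> - 2) *
    (2 * x * (\<phi> x \<bullet> d x) - (\<alpha> + 1) * (\<phi> x \<bullet> \<phi> x))" for x
  have vanish: "g x = 0" "h x = 0" "F x = 0" "f x = 0" if "x \<in> U" for x
    using \<phi>0[OF that] d0[OF that] by (simp_all add: g_def h_def F_def f_def)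
  have cont: "isCont g x" "isCont h x" "isCont f x" for x
  proof -
    have "isCont g x \<and> isCont h x \<and> isCont f x"
    proof (cases "x = 0")
      case True
      then show ?thesis
        using U0 vanish isCont_if_eq_0_on_open[OF \<open>open U\<close>] by metis
    next
      case False
      then show ?thesis
        unfolding g_def h_def f_def
        by (intro conjI continuous_intros \<phi>_cont d_cont) auto
    qed
    then show "isCont g x" "isCont h x" "isCont f x" by auto
  qed
  have F_deriv: "(F has_real_derivative f x) (at x)" for x
  proof (cases "x = 0")
    case True
    have "((\<lambda>_. 0) has_real_derivative f x) (at x)"
      using vanish(4)[OF U0] True by simp
    then show ?thesis
      by (rule has_field_derivative_transform_within_open[OF _ \<open>open U\<close>])
        (use True U0 vanish in auto)
  next
    case False
    \<comment> \<open>The real inner product on the complex plane gives the squared modulus as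
      \<open>\<phi> x \<bullet> \<phi> x\<close>, so it is differentiated as a bilinear
      expression.\<close>
    have "((\<lambda>x. \<phi> x \<bullet> \<phi> x) has_real_derivative 2 * (\<phi> x \<bullet> d x)) (at x)"
      using bounded_bilinear.has_vector_derivative[OF bounded_bilinear_inner
          \<phi>_deriv[OF False] \<phi>_deriv[OF False]]
      by (simp add: has_real_derivative_iff_has_vector_derivative inner_commute)
    from DERIV_mult[OF this hardy_weight_has_derivative[OF False, of "- \<alpha> - 2"]]
    show ?thesis
      unfolding F_def f_def by (simp add: algebra_simps)
  qed
  have "(LINT x|lborel. f x) = 0"
    by (rule integral_deriv_vanishing_outside[of F _ "-R" R])
      (use F_deriv cont vanish U_outside \<open>R > 0\<close> in auto)
  moreover have "integrable lborel g" "integrable lborel h" "integrable lborel f"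
    by (rule integrable_continuous_vanishing_outside[of _ "-R" R];
        use cont vanish U_outside in auto)+
  moreover have "(\<alpha> + 1) / 2 * f x \<le> g x - (\<alpha> + 1)\<^sup>2 / 4 * h x" for x
  proof (cases "x = 0")
    case True
    then show ?thesis using vanish U0 by simp
  next
    case False
    then show ?thesis unfolding f_def g_def h_def by (rule hardy_pointwise)
  qed
  ultimately have "(LINT x|lborel. (\<alpha> + 1) / 2 * f x)
      \<le> (LINT x|lborel. g x - (\<alpha> + 1)\<^sup>2 / 4 * h x)"
    by (intro integral_mono) auto
  then have "(\<alpha> + 1)\<^sup>2 / 4 * (LINT x|lborel. h x) \<le> (LINT x|lborel. g x)"
    using \<open>(LINT x|lborel. f x) = 0\<close> \<open>integrable lborel g\<close> \<open>integrable lborel h\<close> by simp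
  then show ?thesis
    unfolding g_def h_def d_def \<phi>_def .
qed

end
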